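(* Let $\mathcal R_{\mathcal X}$ be the distinguished restriction of a planar vector field $\mathcal X$ with nilpotent linearization at the origin, and suppose that near $u=0$ $$\mathcal R_{\mathcal X}(u)=Cu^2\,\frac{a+bu}{d-eu},\qquad Cd\neq0,$$ with real constants $C,a,b,d,e$. Write $\mathcal R_{\mathcal X}(u)=\sum_{k\ge2}g_ku^k$. Then $$g_2=\frac{Ca}{d},$$ whereas, for every $k\ge3$, $$g_k=C\,\frac{e^{\,k-3}}{d^{\,k-1}}\,(ae+bd).$$ As a result, all Taylor coefficients of degree at least three share the factor $\Sigma:=ae+bd$.
   Context: Setting: $\mathcal X$ is a $C^r$ ($r\ge2$) vector field near the origin of $\mathbb R^2$, $\mathcal X(0)=0$, and $A=D\mathcal X(0)$ satisfies $A\ne0$, $A^2=0$, so $\ker A=\operatorname{im}A$ is one-dimensional. For a generator $\mathbf q\neq0$ of $\ker A$, the distinguished restriction is the unique scalar function near $0$ with $A\mathcal X(u\mathbf q)=\mathcal R_{\mathcal X}(u)\mathbf q$. Convention: $e^{0}=1$, also when $e=0$ (here $e$ is a real parameter, not Euler's number). *)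

theory Defs
  imports "HOL-Analysis.Analysis"
begin

text \<open>
  \<open>f\<close> is of class $C^n$ on the open set \<open>S\<close>.  In finite dimension, continuity of all iterated
  directional derivatives is the same as continuity of the iterated Frechet derivatives.
\<close>

primrec Ck_on :: "nat \<Rightarrow> 'a::euclidean_space set \<Rightarrow> ('a \<Rightarrow> 'b::euclidean_space) \<Rightarrow> bool" where
  "Ck_on 0 S f \<longleftrightarrow> continuous_on S f"
| "Ck_on (Suc n) S f \<longleftrightarrow>
     (\<forall>x\<in>S. f differentiable (at x)) \<and> (\<forall>v. Ck_on n S (\<lambda>x. frechet_derivative f (at x) v))"

definition linearization :: "(real^2 \<Rightarrow> real^2) \<Rightarrow> real^2 \<Rightarrow> real^2" where
  "linearization X = frechet_derivative X (at 0)"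

definition nilpotent_linearization :: "(real^2 \<Rightarrow> real^2) \<Rightarrow> bool" where
  "nilpotent_linearization X \<longleftrightarrow>
     linearization X \<noteq> (\<lambda>v. 0) \<and> linearization X \<circ> linearization X = (\<lambda>v. 0)"

definition kernel_generator :: "(real^2 \<Rightarrow> real^2) \<Rightarrow> real^2 \<Rightarrow> bool" where
  "kernel_generator X q \<longleftrightarrow> q \<noteq> 0 \<and> {v. linearization X v = 0} = span {q}"

text \<open>
  The distinguished restriction is only determined as a germ at \<open>0\<close> (there \<open>q \<noteq> 0\<close> makes it
  unique), so it is a relation between \<open>X\<close>, \<open>q\<close> and a representative \<open>R\<close>.
\<close>

definition is_distinguished_restriction ::
    "(real^2 \<Rightarrow> real^2) \<Rightarrow> real^2 \<Rightarrow> (real \<Rightarrow> real) \<Rightarrow> bool" where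
  "is_distinguished_restriction X q R \<longleftrightarrow>
     (\<forall>\<^sub>F u in nhds 0. linearization X (X (u *\<^sub>R q)) = R u *\<^sub>R q)"

definition taylor_coeff :: "(real \<Rightarrow> real) \<Rightarrow> nat \<Rightarrow> real" where
  "taylor_coeff f k = (deriv ^^ k) f 0 / fact k"

text \<open>\<open>f(u)\<close> equals the sum of \<open>g k * u ^ k\<close> over all \<open>k \<ge> 2\<close>, near \<open>u = 0\<close>; the values
  \<open>g 0\<close> and \<open>g 1\<close> are irrelevant.\<close>

definition expands_from_degree_two :: "(real \<Rightarrow> real) \<Rightarrow> (nat \<Rightarrow> real) \<Rightarrow> bool" where
  "expands_from_degree_two f g \<longleftrightarrow>
     (\<forall>\<^sub>F u in nhds 0. (\<lambda>k. g (k + 2) * u ^ (k + 2)) sums f u)"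

end

theory Submission
  imports Defs
begin

text \<open>
  Splitting off the value at \<open>u = 0\<close> gives
  \[ \frac{a + bu}{d - eu} = \frac{a}{d} + \frac{(ae + bd)\,u}{d^2}\cdot\frac{1}{1 - eu/d}, \]
  and after multiplication by $Cu^2$ the first summand gives the term of degree two, and the
  geometric series in $eu/d$ gives all higher ones, each carrying the factor $ae + bd$.
  Existence of the expansion is this computation, which is lemma \<open>mobius_expansion\<close>.

  For uniqueness, any power series that represents a function near \<open>0\<close> can be differentiated
  term by term, hence its coefficients are the Taylor coefficients of the function
  (lemma \<open>fps_nth_eq_taylor_coeff\<close>).  The same fact turns the explicit
  coefficients into the statement on Taylor coefficients.
\<close>

text \<open>
  The derivative of a function has the formal derivative of its expansion as expansion, so
  the derivatives of higher order at \<open>0\<close> are read off by repeating this step.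
\<close>

lemma fps_nth_eq_taylor_coeff:
  assumes "f has_fps_expansion F"
  shows "fps_nth F n = taylor_coeff f n"
  using assms
proof (induction n arbitrary: f F)
  case 0
  then have "eval_fps F 0 = f 0"
    unfolding has_fps_expansion_def using eventually_nhds_x_imp_x by fastforce
  then show ?case
    by (simp add: taylor_coeff_def eval_fps_at_0)
next
  case (Suc n)
  have "fps_nth (fps_deriv F) n = taylor_coeff (deriv f) n"
    using Suc.prems by (intro Suc.IH has_fps_expansion_deriv)
  then have "real (Suc n) * fps_nth F (Suc n) = (deriv ^^ Suc n) f 0 / fact n"
    by (simp add: taylor_coeff_def funpow_Suc_right del: funpow.simps of_nat_Suc)
  then show ?case
    by (simp add: taylor_coeff_def field_simps del: funpow.simps of_nat_Suc)
qed

text \<open>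
  Convergence at one real point $r > 0$ already forces the radius of convergence to be at
  least $r$, so pointwise convergence near \<open>0\<close> provides the positive radius that a formal
  expansion needs.
\<close>

lemma has_fps_expansion_if_sums_near_0:
  fixes f :: "real \<Rightarrow> real"
  assumes "\<forall>\<^sub>F u in nhds 0. (\<lambda>k. c k * u ^ k) sums f u"
  shows "f has_fps_expansion Abs_fps c"
proof -
  obtain r where r: "r > 0" and sums: "\<And>u. \<bar>u\<bar> < r \<Longrightarrow> (\<lambda>k. c k * u ^ k) sums f u"
    using assms by (auto simp: eventually_nhds_metric dist_real_def)
  have "summable (\<lambda>k. c k * (r / 2) ^ k)"
    using sums[of "r / 2"] r by (auto simp: sums_iff)
  then have "ereal (norm (r / 2)) \<le> conv_radius c"
    by (rule conv_radius_geI)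
  moreover have "0 < ereal (norm (r / 2))"
    using r by simp
  ultimately have "fps_conv_radius (Abs_fps c) > 0"
    unfolding fps_conv_radius_def fps_nth_Abs_fps by (rule less_le_trans[rotated])
  moreover have "\<forall>\<^sub>F u in nhds 0. eval_fps (Abs_fps c) u = f u"
    using assms by eventually_elim (simp add: eval_fps_def sums_iff)
  ultimately show ?thesis
    by (simp add: has_fps_expansion_def)
qed

text \<open>
  An expansion from degree two is a power series whose first two coefficients are zero, and a
  power series representing \<open>f\<close> is determined by the derivatives of \<open>f\<close> at \<open>0\<close>.
\<close>

lemma taylor_coeff_if_expands_from_degree_two:
  assumes "expands_from_degree_two f g" and "k \<ge> 2"
  shows "g k = taylor_coeff f k"
proof -
  define c where "c = (\<lambda>k. if k < 2 then 0 else g k)"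
  have "(\<lambda>k. c k * u ^ k) sums f u" if "(\<lambda>k. g (k + 2) * u ^ (k + 2)) sums f u" for u
    using that sums_iff_shift[of "\<lambda>k. c k * u ^ k" 2 "f u"]
    by (simp add: c_def lessThan_nat_numeral)
  then have "\<forall>\<^sub>F u in nhds 0. (\<lambda>k. c k * u ^ k) sums f u"
    using assms(1) by (auto simp: expands_from_degree_two_def elim: eventually_mono)
  then have "c k = taylor_coeff f k"
    using fps_nth_eq_taylor_coeff[OF has_fps_expansion_if_sums_near_0] by simp
  with \<open>k \<ge> 2\<close> show ?thesis
    by (simp add: c_def)
qed

text \<open>
  Once the term of degree two is split off, the rest is a geometric series with ratio
  $eu/d$, which converges for small $u$.  Since \<open>e ^ 0 = 1\<close>, this covers \<open>e = 0\<close>,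
  where the series stops after degree three.
\<close>

lemma mobius_expansion:
  fixes a b C d e :: real
  assumes "d \<noteq> 0"
  defines "g \<equiv> \<lambda>k. if k = 2 then C * a / d
    else C * (e ^ (k - 3) / d ^ (k - 1)) * (a * e + b * d)"
  shows "expands_from_degree_two (\<lambda>u. C * u ^ 2 * ((a + b * u) / (d - e * u))) g"
  unfolding expands_from_degree_two_def
proof -
  have "((\<lambda>u. \<bar>e * u / d\<bar>) \<longlongrightarrow> \<bar>e * 0 / d\<bar>) (nhds 0)"
    using \<open>d \<noteq> 0\<close> by (intro tendsto_intros filterlim_ident)
  then have "\<forall>\<^sub>F u in nhds 0. \<bar>e * u / d\<bar> < 1"
    by (rule order_tendstoD(2)) simp
  then show "\<forall>\<^sub>F u in nhds 0. (\<lambda>k. g (k + 2) * u ^ (k + 2))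
      sums (C * u ^ 2 * ((a + b * u) / (d - e * u)))"
  proof eventually_elim
    case (elim u)
    \<comment> \<open>The term of degree three, from which the geometric series starts.\<close>
    define K where "K = C * (a * e + b * d) * u ^ 3 / d ^ 2"
    have "e * u / d \<noteq> 1"
      using elim by auto
    then have denom: "d - e * u \<noteq> 0"
      using \<open>d \<noteq> 0\<close> by (auto simp: field_simps)
    have coeff: "g (Suc k + 2) * u ^ (Suc k + 2) = K * (e * u / d) ^ k" for k
    proof -
      have "Suc k + 2 = k + 3"
        by simp
      then show ?thesis
        by (simp add: g_def K_def power_add power_divide power_mult_distrib power2_eq_square
            eval_nat_numeral mult_ac)
    qed
    have "(\<lambda>k. K * (e * u / d) ^ k) sums (K * (1 / (1 - e * u / d)))"
      using elim by (intro sums_mult geometric_sums) simp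
    then have "(\<lambda>k. g (k + 2) * u ^ (k + 2)) sums
        (K * (1 / (1 - e * u / d)) + g (0 + 2) * u ^ (0 + 2))"
      unfolding coeff[symmetric] by (rule sums_Suc)
    also have "K * (1 / (1 - e * u / d)) + g (0 + 2) * u ^ (0 + 2) =
        C * u ^ 2 * ((a + b * u) / (d - e * u))"
    proof -
      have "1 / (1 - e * u / d) = d / (d - e * u)"
        using \<open>d \<noteq> 0\<close> by (simp add: field_simps)
      then show ?thesis
        using \<open>d \<noteq> 0\<close> denom
        by (simp add: g_def K_def divide_simps) (simp add: algebra_simps eval_nat_numeral)
    qed
    finally show ?case .
  qed
qed

theorem corollary4p3:
  fixes X :: "real^2 \<Rightarrow> real^2" and U :: "(real^2) set" and r :: nat
    and q :: "real^2" and R :: "real \<Rightarrow> real" and C a b d e :: real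
  assumes "r \<ge> 2" and "open U" and "0 \<in> U" and "Ck_on r U X"
    and "X 0 = 0"
    and "nilpotent_linearization X"
    and "kernel_generator X q"
    and "is_distinguished_restriction X q R"
    and "\<forall>\<^sub>F u in nhds 0. R u = C * u ^ 2 * ((a + b * u) / (d - e * u))"
    and "C * d \<noteq> 0"
  shows "(\<exists>g. expands_from_degree_two R g) \<and>
    (\<forall>g. expands_from_degree_two R g \<longrightarrow>
       g 2 = C * a / d \<and>
       (\<forall>k\<ge>3. g k = C * (e ^ (k - 3) / d ^ (k - 1)) * (a * e + b * d))) \<and>
    (\<forall>k\<ge>3. taylor_coeff R k = (a * e + b * d) * (C * e ^ (k - 3) / d ^ (k - 1)))"
proof -
  define g where "g = (\<lambda>k. if k = 2 then C * a / d
    else C * (e ^ (k - 3) / d ^ (k - 1)) * (a * e + b * d))"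
  have "expands_from_degree_two (\<lambda>u. C * u ^ 2 * ((a + b * u) / (d - e * u))) g"
    using \<open>C * d \<noteq> 0\<close> unfolding g_def by (intro mobius_expansion) simp
  then have g: "expands_from_degree_two R g"
    using assms(9) unfolding expands_from_degree_two_def
    by eventually_elim simp
  have taylor: "taylor_coeff R k = g k" if "k \<ge> 2" for k
    using taylor_coeff_if_expands_from_degree_two[OF g that] by simp
  have unique: "h k = g k" if "expands_from_degree_two R h" "k \<ge> 2" for h k
    using taylor_coeff_if_expands_from_degree_two[OF that] taylor[OF that(2)] by simp
  show ?thesis
  proof (intro conjI allI impI)
    show "\<exists>g. expands_from_degree_two R g"
      using g by blast
    show "h 2 = C * a / d" if "expands_from_degree_two R h" for h
      using unique[OF that] by (simp add: g_def)
    show "h k = C * (e ^ (k - 3) / d ^ (k - 1)) * (a * e + b * d)"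
      if "expands_from_degree_two R h" "k \<ge> 3" for h k
      using unique[OF that(1), of k] that(2) by (simp add: g_def)
    show "taylor_coeff R k = (a * e + b * d) * (C * e ^ (k - 3) / d ^ (k - 1))"
      if "k \<ge> 3" for k
      using taylor[of k] that by (simp add: g_def)
  qed
qed

end
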